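(* Let $(\mathbf E,\|\cdot\|)$ be a normed space and let $F:\mathbf E\to\mathbb R$ be $L_0$-Lipschitz and $L_1$-smooth w.r.t. $\|\cdot\|$. Let $x^1,\dots,x^T\in\mathbf E$ be deterministic vectors, $(\lambda_1,\dots,\lambda_T)\in\Delta_T$, and let $a^1,\dots,a^T$ be random vectors in $\mathbf E$ such that $\mathbb E[a^t\mid a^{t-1},\dots,a^1]=x^t$ for all $t\in[T]$. Suppose $\|x^t-a^t\|\le D$ almost surely for all $t\in[T]$. Let $\bar x^T=\sum_{t=1}^T\lambda_tx^t$ and $\bar a^T=\sum_{t=1}^T\lambda_ta^t$. Then, for any $\beta>0$, $$\mathbb P\left[F(\bar a^T)-F(\bar x^T)\ge\frac{L_1D^2}{2}\sum_{t=1}^T\lambda_t^2+\beta\sqrt2\,L_0D\sqrt{\sum_{t=1}^T\lambda_t^2}\,\right]\le\exp(-\beta^2).$$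
   Context: $\Delta_T=\{\lambda\in\mathbb R^T:\lambda_t\ge0,\ \sum_t\lambda_t=1\}$. With $\|\cdot\|_*$ the dual norm, a differentiable function $F$ is $L_0$-Lipschitz w.r.t. $\|\cdot\|$ if $\|\nabla F(u)\|_*\le L_0$ for all $u$, and $L_1$-smooth if $\|\nabla F(u)-\nabla F(u')\|_*\le L_1\|u-u'\|$ for all $u,u'$.
   Formalization: Assumes D > 0, L_1 ≥ 0, and that L_0, L_1 are not both zero: if D = 0 or L_0 = L_1 = 0 the event reads 0 ≥ 0 and has probability 1 > exp(−β²), so the claim fails there; L_1 ≥ 0 is automatic unless E = {0}. *)

theory Defs
  imports "HOL-Probability.Probability"
begin

section \<open>Differentiable functions on a normed space\<close>

text \<open>
  The gradient of \<open>F\<close> at \<open>u\<close> is the Frechet derivative, an element of the dual space.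
  The library's operator norm \<open>onorm\<close> of a bounded linear functional is its dual norm.
\<close>

definition lipschitz_by_gradient :: "real \<Rightarrow> ('e::real_normed_vector \<Rightarrow> real) \<Rightarrow> bool" where
  "lipschitz_by_gradient L0 F \<longleftrightarrow>
     (\<forall>u. F differentiable (at u)) \<and>
     (\<forall>u. onorm (frechet_derivative F (at u)) \<le> L0)"

definition smooth_by_gradient :: "real \<Rightarrow> ('e::real_normed_vector \<Rightarrow> real) \<Rightarrow> bool" where
  "smooth_by_gradient L1 F \<longleftrightarrow>
     (\<forall>u. F differentiable (at u)) \<and>
     (\<forall>u u'. onorm (\<lambda>h. frechet_derivative F (at u) h - frechet_derivative F (at u') h)
                \<le> L1 * norm (u - u'))"

section \<open>Random vectors in an arbitrary normed space\<close>

text \<open>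
  The library's Bochner integral requires a second countable codomain. To cover every normed
  space, a random vector is here a strongly measurable function (Borel measurable with separable
  range), and the integral is the library's, without the sort constraint. For second
  countable codomains both notions are those of the library, see the two lemmas below.
\<close>

definition strongly_measurable :: "'w measure \<Rightarrow> ('w \<Rightarrow> 'e::real_normed_vector) \<Rightarrow> bool" where
  "strongly_measurable M X \<longleftrightarrow>
     X \<in> borel_measurable M \<and> (\<exists>S. countable S \<and> X ` space M \<subseteq> closure S)"

definition has_vector_integral ::
  "'w measure \<Rightarrow> ('w \<Rightarrow> 'e::real_normed_vector) \<Rightarrow> 'e \<Rightarrow> bool" where
  "has_vector_integral M X v \<longleftrightarrow>
     strongly_measurable M X \<and>
     (\<exists>s. (\<forall>i. Bochner_Integration.simple_bochner_integrable M (s i)) \<and>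
          (\<lambda>i. \<integral>\<^sup>+\<omega>. norm (X \<omega> - s i \<omega>) \<partial>M) \<longlonglongrightarrow> 0 \<and>
          (\<lambda>i. Bochner_Integration.simple_bochner_integral M (s i)) \<longlonglongrightarrow> v)"

lemma strongly_measurable_iff_borel_measurable:
  fixes X :: "'w \<Rightarrow> 'e::{real_normed_vector, second_countable_topology}"
  shows "strongly_measurable M X \<longleftrightarrow> X \<in> borel_measurable M"
proof -
  obtain S :: "'e set" where S: "countable S" "\<And>U. open U \<Longrightarrow> U \<noteq> {} \<Longrightarrow> \<exists>d\<in>S. d \<in> U"
    using countable_dense_setE by blast
  have "x \<in> closure S" for x
  proof (rule ccontr)
    assume "x \<notin> closure S"
    then have "- closure S \<noteq> {}" "open (- closure S)" by auto
    then obtain d where "d \<in> S" "d \<in> - closure S" using S(2) by blast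
    then show False using closure_subset by blast
  qed
  then show ?thesis
    using S(1) unfolding strongly_measurable_def by auto
qed

lemma has_vector_integral_iff_has_bochner_integral:
  fixes X :: "'w \<Rightarrow> 'e::{real_normed_vector, second_countable_topology}"
  shows "has_vector_integral M X v \<longleftrightarrow> has_bochner_integral M X v"
  unfolding has_vector_integral_def strongly_measurable_iff_borel_measurable
    has_bochner_integral.simps by blast

text \<open>
  \<open>Y\<close> is a version of the conditional expectation of \<open>X\<close> given the sub-sigma-algebra \<open>G\<close>.
  The case \<open>A = space M\<close> expresses that both are integrable.
\<close>

definition is_cond_expectation ::
  "'w measure \<Rightarrow> 'w measure \<Rightarrow> ('w \<Rightarrow> 'e::real_normed_vector) \<Rightarrow> ('w \<Rightarrow> 'e) \<Rightarrow> bool" where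
  "is_cond_expectation M G X Y \<longleftrightarrow>
     subalgebra M G \<and> strongly_measurable G Y \<and>
     (\<forall>A\<in>sets G. \<exists>v. has_vector_integral M (\<lambda>\<omega>. indicator A \<omega> *\<^sub>R X \<omega>) v \<and>
                     has_vector_integral M (\<lambda>\<omega>. indicator A \<omega> *\<^sub>R Y \<omega>) v)"

text \<open>The sigma-algebra generated by \<open>a 1, \<dots>, a (t - 1)\<close>, which is trivial for \<open>t = 1\<close>.\<close>

definition past ::
  "'w measure \<Rightarrow> (nat \<Rightarrow> 'w \<Rightarrow> 'e::real_normed_vector) \<Rightarrow> nat \<Rightarrow> 'w measure" where
  "past M a t = sigma (space M) {a s -` B \<inter> space M | s B. s \<in> {1..<t} \<and> B \<in> sets borel}"

definition prob_simplex :: "nat \<Rightarrow> (nat \<Rightarrow> real) set" where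
  "prob_simplex T = {l. (\<forall>t\<in>{1..T}. 0 \<le> l t) \<and> (\<Sum>t=1..T. l t) = 1}"

end

theory Submission
  imports Defs
begin

text \<open>
  Along the path \<open>y\<^sub>t = xbar + (\<Sum>s\<le>t. l s *\<^sub>R (a s - x s))\<close>, smoothness bounds the increment
  \<open>F y\<^sub>t - F y\<^sub>t\<^sub>-\<^sub>1\<close> by \<open>F' y\<^sub>t\<^sub>-\<^sub>1 (l t *\<^sub>R (a t - x t)) + L1 / 2 * (l t * D)\<^sup>2\<close>. The linear terms are
  martingale differences bounded by \<open>L0 * D * l t\<close>, so Azuma's inequality applies to their sum.

  The space need not be separable, so the measurability of the linear terms and the vanishing of
  their conditional means are not immediate. Therefore \<open>F'\<close> is evaluated not at the path
  itself, but at a path within distance \<open>\<eta>\<close> that takes countably many values, for which both reduce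
  to a single functional. By smoothness this costs an error of order \<open>\<eta>\<close>, and \<open>\<eta> \<rightarrow> 0\<close> at the end.
\<close>

section \<open>Smooth functions\<close>

lemma abs_bounded_linear_le:
  fixes f :: "'e::real_normed_vector \<Rightarrow> real"
  assumes "bounded_linear f" "onorm f \<le> K" "norm h \<le> r"
  shows "\<bar>f h\<bar> \<le> K * r"
proof -
  have "\<bar>f h\<bar> \<le> onorm f * norm h"
    using onorm[OF assms(1), of h] by simp
  also have "\<dots> \<le> K * r"
    using assms onorm_pos_le[OF assms(1)] by (intro mult_mono) auto
  finally show ?thesis .
qed

lemma lipschitz_by_gradientD:
  assumes "lipschitz_by_gradient L0 F"
  shows "(F has_derivative frechet_derivative F (at u)) (at u)"
    and "bounded_linear (frechet_derivative F (at u))"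
    and "onorm (frechet_derivative F (at u)) \<le> L0"
    and "0 \<le> L0"
proof -
  show *: "(F has_derivative frechet_derivative F (at u)) (at u)"
    using assms frechet_derivative_works unfolding lipschitz_by_gradient_def by blast
  show bl: "bounded_linear (frechet_derivative F (at u))"
    using has_derivative_bounded_linear[OF *] .
  show le: "onorm (frechet_derivative F (at u)) \<le> L0"
    using assms unfolding lipschitz_by_gradient_def by blast
  show "0 \<le> L0" using onorm_pos_le[OF bl] le by linarith
qed

lemma smooth_by_gradientD:
  assumes "smooth_by_gradient L1 F"
  shows "(F has_derivative frechet_derivative F (at u)) (at u)"
    and "\<bar>frechet_derivative F (at u) h - frechet_derivative F (at v) h\<bar> \<le> L1 * norm (u - v) * norm h"
proof -
  have *: "(F has_derivative frechet_derivative F (at w)) (at w)" for w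
    using assms frechet_derivative_works unfolding smooth_by_gradient_def by blast
  then show "(F has_derivative frechet_derivative F (at u)) (at u)" .
  have "bounded_linear (\<lambda>h. frechet_derivative F (at u) h - frechet_derivative F (at v) h)"
    by (intro bounded_linear_sub has_derivative_bounded_linear[OF *])
  then show "\<bar>frechet_derivative F (at u) h - frechet_derivative F (at v) h\<bar> \<le> L1 * norm (u - v) * norm h"
    using assms abs_bounded_linear_le[of "\<lambda>h. frechet_derivative F (at u) h - frechet_derivative F (at v) h"
      "L1 * norm (u - v)" h "norm h"]
    unfolding smooth_by_gradient_def by simp
qed

text \<open>The descent lemma. \<open>\<phi>\<close> is \<open>F\<close> along the segment from
  \<open>y\<close> to \<open>y + h\<close> minus its first-order term and the quadratic allowance;
  smoothness makes its derivative nonpositive.\<close>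

lemma smooth_quadratic_upper_bound:
  assumes "smooth_by_gradient L1 F"
  shows "F (y + h) \<le> F y + frechet_derivative F (at y) h + L1 / 2 * (norm h)\<^sup>2"
proof -
  define F' where "F' u = frechet_derivative F (at u)" for u
  have F': "(F has_derivative F' u) (at u)" for u
    unfolding F'_def by (rule smooth_by_gradientD(1)[OF assms])
  define \<phi> where "\<phi> \<tau> = F (y + \<tau> *\<^sub>R h) - \<tau> * F' y h - L1 / 2 * \<tau>\<^sup>2 * (norm h)\<^sup>2" for \<tau>
  have "\<phi> 1 \<le> \<phi> 0"
  proof (rule DERIV_nonpos_imp_nonincreasing[of 0 1 \<phi>])
    fix \<tau> :: real assume \<tau>: "0 \<le> \<tau>" "\<tau> \<le> 1"
    have "((\<lambda>\<tau>. F (y + \<tau> *\<^sub>R h)) has_derivative (\<lambda>s. F' (y + \<tau> *\<^sub>R h) (s *\<^sub>R h))) (at \<tau>)"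
      by (rule has_derivative_compose[where f = "\<lambda>\<tau>. y + \<tau> *\<^sub>R h", OF _ F'])
        (auto intro!: derivative_eq_intros)
    moreover have "F' (y + \<tau> *\<^sub>R h) (s *\<^sub>R h) = s * F' (y + \<tau> *\<^sub>R h) h" for s
      using linear_cmul[OF has_derivative_linear[OF F']] by simp
    ultimately have "((\<lambda>\<tau>. F (y + \<tau> *\<^sub>R h)) has_real_derivative F' (y + \<tau> *\<^sub>R h) h) (at \<tau>)"
      by (simp add: has_field_derivative_def mult_commute_abs)
    then have "(\<phi> has_real_derivative
        F' (y + \<tau> *\<^sub>R h) h - F' y h - L1 * \<tau> * (norm h)\<^sup>2) (at \<tau>)"
      unfolding \<phi>_def by (auto intro!: derivative_eq_intros)
    moreover have "\<bar>F' (y + \<tau> *\<^sub>R h) h - F' y h\<bar> \<le> L1 * norm (y + \<tau> *\<^sub>R h - y) * norm h"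
      unfolding F'_def by (rule smooth_by_gradientD(2)[OF assms])
    then have "F' (y + \<tau> *\<^sub>R h) h - F' y h - L1 * \<tau> * (norm h)\<^sup>2 \<le> 0"
      using \<tau> by (simp add: power2_eq_square mult.assoc)
    ultimately show "\<exists>d. (\<phi> has_real_derivative d) (at \<tau>) \<and> d \<le> 0" by blast
  qed simp
  then show ?thesis by (simp add: \<phi>_def F'_def)
qed

text \<open>The descent lemma, telescoped over the steps. Moving the gradient from the current point
  to \<open>z t\<close> costs at most \<open>L1 * \<eta> * (l t * D)\<close>. The point
  \<open>z t\<close> is compared with the path before step \<open>t\<close>, so it can be chosen
  from the past alone.\<close>

lemma smooth_along_path_upper_bound:
  fixes v z :: "nat \<Rightarrow> 'e::real_normed_vector"
  assumes F: "smooth_by_gradient L1 F" "0 \<le> L1"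
    and l: "\<And>t. t \<in> {1..n} \<Longrightarrow> 0 \<le> l t"
    and v: "\<And>t. t \<in> {1..n} \<Longrightarrow> norm (v t) \<le> D"
    and z: "\<And>t. t \<in> {1..n} \<Longrightarrow> norm (y + (\<Sum>s\<in>{1..<t}. l s *\<^sub>R v s) - z t) \<le> \<eta>"
  shows "F (y + (\<Sum>t=1..n. l t *\<^sub>R v t)) \<le>
    F y + (\<Sum>t=1..n. frechet_derivative F (at (z t)) (l t *\<^sub>R v t))
      + L1 * D\<^sup>2 / 2 * (\<Sum>t=1..n. (l t)\<^sup>2) + L1 * \<eta> * D * (\<Sum>t=1..n. l t)"
  using l v z
proof (induction n)
  case (Suc n)
  let ?F' = "\<lambda>u. frechet_derivative F (at u)"
  define w where "w = y + (\<Sum>t=1..n. l t *\<^sub>R v t)"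
  define h where "h = l (Suc n) *\<^sub>R v (Suc n)"
  have n: "Suc n \<in> {1..Suc n}" by simp
  have h: "norm h \<le> l (Suc n) * D"
    unfolding h_def using Suc.prems(1,2)[OF n] by (simp add: mult_left_mono)
  have wz: "norm (w - z (Suc n)) \<le> \<eta>"
    using Suc.prems(3)[OF n] by (simp add: w_def atLeastLessThanSuc_atLeastAtMost)
  have "F (w + h) \<le> F w + ?F' w h + L1 / 2 * (norm h)\<^sup>2"
    by (rule smooth_quadratic_upper_bound[OF F(1)])
  moreover have "?F' w h - ?F' (z (Suc n)) h \<le> L1 * \<eta> * (l (Suc n) * D)"
  proof -
    have "?F' w h - ?F' (z (Suc n)) h \<le> L1 * norm (w - z (Suc n)) * norm h"
      using smooth_by_gradientD(2)[OF F(1)] abs_le_D1 by blast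
    \<comment> \<open>Monotonicity needs \<open>0 \<le> \<eta>\<close>, which holds because \<eta>
      bounds a norm.\<close>
    also have "\<dots> \<le> L1 * \<eta> * (l (Suc n) * D)"
      using h wz F(2) order_trans[OF norm_ge_zero wz] by (intro mult_mono) auto
    finally show ?thesis .
  qed
  moreover have "L1 / 2 * (norm h)\<^sup>2 \<le> L1 / 2 * (l (Suc n) * D)\<^sup>2"
    using h F(2) by (intro mult_left_mono power_mono) auto
  moreover have "F w \<le> F y + (\<Sum>t=1..n. ?F' (z t) (l t *\<^sub>R v t))
      + L1 * D\<^sup>2 / 2 * (\<Sum>t=1..n. (l t)\<^sup>2) + L1 * \<eta> * D * (\<Sum>t=1..n. l t)"
    unfolding w_def by (rule Suc.IH) (use Suc.prems in auto)
  moreover have "y + (\<Sum>t=1..Suc n. l t *\<^sub>R v t) = w + h"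
    by (simp add: w_def h_def add.assoc)
  ultimately show ?case
    by (simp add: h_def[symmetric] power_mult_distrib algebra_simps)
qed simp

section \<open>Sums of bounded martingale differences\<close>

text \<open>Hoeffding's lemma for a variable equal to \<open>u\<close> or \<open>- u\<close> with
  probability 1/2 each: the mean of its exponential is \<open>cosh u\<close>.\<close>

lemma cosh_le_exp_square_half:
  fixes u :: real
  assumes "0 \<le> u"
  shows "cosh u \<le> exp (u\<^sup>2 / 2)"
proof -
  \<comment> \<open>Probability 1/2 and interval length \<open>2 * u\<close>: then
    \<open>(2 * u)\<^sup>2 / 8 = u\<^sup>2 / 2\<close>, and the argument of \<open>ln\<close> is
    \<open>exp u * cosh u\<close>.\<close>
  have "- (2 * u) * (1/2) + ln (1 + 1/2 * (exp (2 * u) - 1)) \<le> (2 * u)\<^sup>2 / 8"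
    using assms by (intro Hoeffdings_lemma_aux) auto
  then have "ln (1 + 1/2 * (exp (2 * u) - 1)) \<le> u + u\<^sup>2 / 2"
    by (simp add: power2_eq_square)
  moreover have pos: "0 < 1 + 1/2 * (exp (2 * u) - 1)"
    by (simp add: field_simps add_pos_pos)
  ultimately have "1 + 1/2 * (exp (2 * u) - 1) \<le> exp (u + u\<^sup>2 / 2)"
    by (metis exp_le_cancel_iff exp_ln)
  moreover have "1 + 1/2 * (exp (2 * u) - 1) = exp u * cosh u"
    by (simp add: cosh_field_def field_simps flip: exp_add)
  ultimately show ?thesis by (simp add: exp_add)
qed

text \<open>For \<open>c = 0\<close> the slope is \<open>0 / 0 = 0\<close>, and the bound still holds.\<close>

lemma exp_le_chord:
  fixes \<theta> c z :: real
  assumes "0 \<le> \<theta>" "\<bar>z\<bar> \<le> c"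
  shows "exp (\<theta> * z) \<le> cosh (\<theta> * c) + sinh (\<theta> * c) / c * z"
proof (cases "c = 0")
  case False
  then have c: "0 < c" using assms by auto
  \<comment> \<open>The weight of the endpoint \<open>c\<close> when \<open>z\<close> is written as
    a convex combination of \<open>- c\<close> and \<open>c\<close>.\<close>
  define p where "p = (c + z) / (2 * c)"
  have p: "0 \<le> p" "p \<le> 1"
    using c assms by (auto simp: p_def field_simps)
  have "exp (\<theta> * ((1 - p) *\<^sub>R (- c) + p *\<^sub>R c)) \<le> (1 - p) * exp (\<theta> * (- c)) + p * exp (\<theta> * c)"
    by (rule convex_onD[OF convex_on_exp[OF assms(1)]]) (use p in auto)
  moreover have "(1 - p) *\<^sub>R (- c) + p *\<^sub>R c = z"
    using c by (simp add: p_def field_simps)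
  moreover have "(1 - p) * exp (\<theta> * (- c)) + p * exp (\<theta> * c) = cosh (\<theta> * c) + sinh (\<theta> * c) / c * z"
    using c by (simp add: p_def cosh_field_def sinh_field_def field_simps)
  ultimately show ?thesis by simp
qed (use assms in simp)

text \<open>The vanishing set integrals say that \<open>Z\<close> has conditional expectation 0
  given \<open>G\<close>, and the bounded \<open>G\<close>-measurable factor \<open>H\<close> can be
  pulled out of it.\<close>

lemma integral_mult_martingale_difference_eq_0:
  fixes H Z :: "'w \<Rightarrow> real"
  assumes "prob_space M" "subalgebra M G"
    and H: "H \<in> borel_measurable G" "AE \<omega> in M. \<bar>H \<omega>\<bar> \<le> B"
    and Z: "integrable M Z" "\<And>A. A \<in> sets G \<Longrightarrow> (LINT \<omega>:A|M. Z \<omega>) = 0"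
  shows "integrable M (\<lambda>\<omega>. H \<omega> * Z \<omega>)" "(\<integral>\<omega>. H \<omega> * Z \<omega> \<partial>M) = 0"
proof -
  interpret prob_space M by fact
  interpret finite_measure_subalgebra M G by unfold_locales fact
  have [measurable]: "H \<in> borel_measurable M"
    by (rule measurable_from_subalg[OF assms(2) H(1)])
  have [measurable]: "Z \<in> borel_measurable M" using Z(1) by auto
  show int: "integrable M (\<lambda>\<omega>. H \<omega> * Z \<omega>)"
  proof (rule Bochner_Integration.integrable_bound)
    show "integrable M (\<lambda>\<omega>. B * Z \<omega>)" using Z(1) by auto
    show "AE \<omega> in M. norm (H \<omega> * Z \<omega>) \<le> norm (B * Z \<omega>)"
      using H(2) by eventually_elim (auto simp: abs_mult intro!: mult_right_mono)
  qed measurable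
  have "AE \<omega> in M. real_cond_exp M G Z \<omega> = 0"
    by (rule real_cond_exp_charact) (use Z in \<open>auto simp: set_lebesgue_integral_def\<close>)
  then have "(\<integral>\<omega>. H \<omega> * real_cond_exp M G Z \<omega> \<partial>M) = (\<integral>\<omega>. 0 \<partial>M)"
    by (intro integral_cong_AE) auto
  then show "(\<integral>\<omega>. H \<omega> * Z \<omega> \<partial>M) = 0"
    using real_cond_exp_intg(2)[OF int H(1)] by simp
qed

text \<open>Azuma's moment bound, peeling off the last step. The chord bound is affine in
  \<open>Z (Suc n)\<close>; its linear part times the past factor \<open>H\<close> integrates to 0,
  so the step contributes only the factor \<open>cosh (\<theta> * C)\<close>.\<close>

lemma exp_sum_martingale_differences_le:
  fixes Z :: "nat \<Rightarrow> 'w \<Rightarrow> real" and \<theta> :: real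
  assumes "prob_space M" "0 \<le> \<theta>"
    and sub: "\<And>t. t \<in> {1..T} \<Longrightarrow> subalgebra M (G t)"
    and adapted: "\<And>s t. t \<in> {1..T} \<Longrightarrow> s \<in> {1..<t} \<Longrightarrow> Z s \<in> borel_measurable (G t)"
    and meas: "\<And>t. t \<in> {1..T} \<Longrightarrow> Z t \<in> borel_measurable M"
    and bound: "\<And>t. t \<in> {1..T} \<Longrightarrow> AE \<omega> in M. \<bar>Z t \<omega>\<bar> \<le> c t"
    and mean0: "\<And>t A. t \<in> {1..T} \<Longrightarrow> A \<in> sets (G t) \<Longrightarrow> (LINT \<omega>:A|M. Z t \<omega>) = 0"
  shows "integrable M (\<lambda>\<omega>. exp (\<theta> * (\<Sum>t=1..T. Z t \<omega>)))"
    and "(\<integral>\<omega>. exp (\<theta> * (\<Sum>t=1..T. Z t \<omega>)) \<partial>M) \<le> exp (\<theta>\<^sup>2 / 2 * (\<Sum>t=1..T. (c t)\<^sup>2))"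
proof -
  interpret prob_space M by fact
  \<comment> \<open>This bound gives integrability and makes \<open>H\<close> below admissible as a
    bounded multiplier.\<close>
  have bounded: "AE \<omega> in M. \<bar>exp (\<theta> * (\<Sum>t=1..n. Z t \<omega>))\<bar> \<le> exp (\<theta> * (\<Sum>t=1..n. c t))"
    if "n \<le> T" for n
  proof -
    have "AE \<omega> in M. \<forall>t\<in>{1..n}. \<bar>Z t \<omega>\<bar> \<le> c t"
      using bound that by (intro AE_finite_allI) auto
    then show ?thesis
    proof eventually_elim
      case (elim \<omega>)
      then have "(\<Sum>t=1..n. Z t \<omega>) \<le> (\<Sum>t=1..n. c t)"
        by (intro sum_mono) (use abs_le_D1 in blast)
      then show ?case using \<open>0 \<le> \<theta>\<close> by (simp add: mult_left_mono)
    qed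
  qed
  have int: "integrable M (\<lambda>\<omega>. exp (\<theta> * (\<Sum>t=1..n. Z t \<omega>)))" if "n \<le> T" for n
  proof (rule integrable_const_bound)
    show "AE \<omega> in M. norm (exp (\<theta> * (\<Sum>t=1..n. Z t \<omega>))) \<le> exp (\<theta> * (\<Sum>t=1..n. c t))"
      using bounded[OF that] by simp
    have [measurable]: "Z t \<in> borel_measurable M" if "t \<in> {1..n}" for t
      using meas that \<open>n \<le> T\<close> by auto
    show "(\<lambda>\<omega>. exp (\<theta> * (\<Sum>t=1..n. Z t \<omega>))) \<in> borel_measurable M"
      by measurable
  qed
  show "integrable M (\<lambda>\<omega>. exp (\<theta> * (\<Sum>t=1..T. Z t \<omega>)))" by (rule int) simp
  have "(\<integral>\<omega>. exp (\<theta> * (\<Sum>t=1..n. Z t \<omega>)) \<partial>M) \<le> exp (\<theta>\<^sup>2 / 2 * (\<Sum>t=1..n. (c t)\<^sup>2))"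
    if "n \<le> T" for n using that
  proof (induction n)
    case 0
    then show ?case by (simp add: prob_space)
  next
    case (Suc n)
    define H where "H \<omega> = exp (\<theta> * (\<Sum>t=1..n. Z t \<omega>))" for \<omega>
    define C where "C = c (Suc n)"
    have t: "Suc n \<in> {1..T}" using Suc.prems by auto
    \<comment> \<open>The sign is read off from the almost sure bound: in a probability space a
      constant statement that holds almost surely is true.\<close>
    have C: "0 \<le> C"
    proof -
      have "AE \<omega> in M. 0 \<le> C" using bound[OF t] unfolding C_def by eventually_elim auto
      then show ?thesis by simp
    qed
    have H_G: "H \<in> borel_measurable (G (Suc n))"
    proof -
      have [measurable]: "Z s \<in> borel_measurable (G (Suc n))" if "s \<in> {1..n}" for s
        using adapted[OF t] that by auto
      show ?thesis unfolding H_def by measurable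
    qed
    have intH: "integrable M H" unfolding H_def using int Suc.prems by simp
    have intZ: "integrable M (Z (Suc n))"
      using bound[OF t] meas[OF t] by (intro integrable_const_bound) auto
    have H_bounded: "AE \<omega> in M. \<bar>H \<omega>\<bar> \<le> exp (\<theta> * (\<Sum>t=1..n. c t))"
      unfolding H_def using bounded Suc.prems by simp
    have HZ: "integrable M (\<lambda>\<omega>. H \<omega> * Z (Suc n) \<omega>)" "(\<integral>\<omega>. H \<omega> * Z (Suc n) \<omega> \<partial>M) = 0"
      using integral_mult_martingale_difference_eq_0[OF \<open>prob_space M\<close> sub[OF t] H_G _ intZ mean0[OF t]]
        H_bounded by blast+
    let ?k = "sinh (\<theta> * C) / C"
    have "(\<integral>\<omega>. exp (\<theta> * (\<Sum>t=1..Suc n. Z t \<omega>)) \<partial>M)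
        \<le> (\<integral>\<omega>. cosh (\<theta> * C) * H \<omega> + ?k * (H \<omega> * Z (Suc n) \<omega>) \<partial>M)"
    proof (rule integral_mono_AE)
      show "integrable M (\<lambda>\<omega>. exp (\<theta> * (\<Sum>t=1..Suc n. Z t \<omega>)))" using int Suc.prems by blast
      show "integrable M (\<lambda>\<omega>. cosh (\<theta> * C) * H \<omega> + ?k * (H \<omega> * Z (Suc n) \<omega>))"
        using intH HZ(1) by auto
      show "AE \<omega> in M. exp (\<theta> * (\<Sum>t=1..Suc n. Z t \<omega>)) \<le> cosh (\<theta> * C) * H \<omega> + ?k * (H \<omega> * Z (Suc n) \<omega>)"
        using bound[OF t]
      proof eventually_elim
        case (elim \<omega>)
        have "exp (\<theta> * (\<Sum>t=1..Suc n. Z t \<omega>)) = H \<omega> * exp (\<theta> * Z (Suc n) \<omega>)"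
          by (simp add: H_def distrib_left exp_add)
        also have "\<dots> \<le> H \<omega> * (cosh (\<theta> * C) + ?k * Z (Suc n) \<omega>)"
          using elim \<open>0 \<le> \<theta>\<close> by (intro mult_left_mono exp_le_chord) (auto simp: C_def H_def)
        finally show ?case by (simp add: algebra_simps)
      qed
    qed
    also have "\<dots> = cosh (\<theta> * C) * (\<integral>\<omega>. H \<omega> \<partial>M)"
      using intH HZ by simp
    also have "\<dots> \<le> exp ((\<theta> * C)\<^sup>2 / 2) * exp (\<theta>\<^sup>2 / 2 * (\<Sum>t=1..n. (c t)\<^sup>2))"
      using Suc C \<open>0 \<le> \<theta>\<close> by (intro mult_mono cosh_le_exp_square_half) (auto simp: H_def)
    also have "\<dots> = exp (\<theta>\<^sup>2 / 2 * (\<Sum>t=1..Suc n. (c t)\<^sup>2))"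
      by (simp add: C_def field_simps flip: exp_add)
    finally show ?case .
  qed
  then show "(\<integral>\<omega>. exp (\<theta> * (\<Sum>t=1..T. Z t \<omega>)) \<partial>M) \<le> exp (\<theta>\<^sup>2 / 2 * (\<Sum>t=1..T. (c t)\<^sup>2))"
    by simp
qed

section \<open>Linear functionals of random vectors\<close>

text \<open>\<open>f\<close> sends the approximating simple functions to real simple functions and
  enlarges the mean error by at most the factor \<open>K\<close>. This carries vector integrals over
  to ordinary real integration.\<close>

lemma has_vector_integral_bounded_linear:
  fixes f :: "'e::real_normed_vector \<Rightarrow> real"
  assumes "bounded_linear f" "has_vector_integral M X v"
  shows "has_bochner_integral M (\<lambda>\<omega>. f (X \<omega>)) (f v)"
proof -
  interpret f: bounded_linear f by fact
  have [measurable]: "f \<in> borel_measurable borel"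
    by (intro borel_measurable_continuous_onI f.continuous_on continuous_on_id)
  obtain s where X[measurable]: "X \<in> borel_measurable M"
    and s: "\<And>i. Bochner_Integration.simple_bochner_integrable M (s i)"
    and lim: "(\<lambda>i. \<integral>\<^sup>+\<omega>. norm (X \<omega> - s i \<omega>) \<partial>M) \<longlonglongrightarrow> 0"
    and v: "(\<lambda>i. Bochner_Integration.simple_bochner_integral M (s i)) \<longlonglongrightarrow> v"
    using assms(2) unfolding has_vector_integral_def strongly_measurable_def by blast
  obtain K where K: "K > 0" "\<And>h. norm (f h) \<le> norm h * K"
    using f.pos_bounded by auto
  show ?thesis
  proof (rule has_bochner_integral.intros)
    show "(\<lambda>\<omega>. f (X \<omega>)) \<in> borel_measurable M" by measurable
    show "Bochner_Integration.simple_bochner_integrable M (\<lambda>\<omega>. f (s i \<omega>))" for i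
      by (rule Bochner_Integration.simple_bochner_integrable_compose2[where p = "\<lambda>h _. f h", OF f.zero s s])
    show "(\<lambda>i. \<integral>\<^sup>+\<omega>. norm (f (X \<omega>) - f (s i \<omega>)) \<partial>M) \<longlonglongrightarrow> 0" (is "?f \<longlonglongrightarrow> 0")
    proof (rule tendsto_sandwich)
      show "eventually (\<lambda>n. 0 \<le> ?f n) sequentially" "(\<lambda>_. 0) \<longlonglongrightarrow> (0::ennreal)"
        by auto
      show "eventually (\<lambda>i. ?f i \<le> K * (\<integral>\<^sup>+\<omega>. norm (X \<omega> - s i \<omega>) \<partial>M)) sequentially"
      proof (intro always_eventually allI)
        fix i
        \<comment> \<open>In a nonseparable space a difference of Borel functions may fail to be
          Borel. Here \<open>s i\<close> has finitely many values, and for each fixed value the norm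
          is continuous in \<open>X\<close>.\<close>
        have [measurable]: "(\<lambda>\<omega>. norm (X \<omega> - s i \<omega>)) \<in> borel_measurable M"
        proof -
          have sf: "simple_function M (s i)"
            using s[of i] by (auto elim: Bochner_Integration.simple_bochner_integrable.cases)
          have "(\<lambda>\<omega>. norm (X \<omega> - w)) \<in> borel_measurable M" for w
            by (rule measurable_compose[OF X])
              (auto intro!: borel_measurable_continuous_onI continuous_intros)
          then show ?thesis
            by (rule measurable_compose_countable'[where g = "s i" and I = "s i ` space M"])
              (use sf in \<open>auto simp: simple_function_def countable_finite intro!: measurable_count_space_eq2[THEN iffD2]\<close>)
        qed
        have "?f i \<le> (\<integral>\<^sup>+\<omega>. ennreal K * norm (X \<omega> - s i \<omega>) \<partial>M)"
          using K by (intro nn_integral_mono)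
            (auto simp: ac_simps ennreal_mult[symmetric] simp flip: f.diff real_norm_def)
        also have "\<dots> = K * (\<integral>\<^sup>+\<omega>. norm (X \<omega> - s i \<omega>) \<partial>M)"
          using K by (intro nn_integral_cmult) auto
        finally show "?f i \<le> K * (\<integral>\<^sup>+\<omega>. norm (X \<omega> - s i \<omega>) \<partial>M)" .
      qed
      show "(\<lambda>i. K * (\<integral>\<^sup>+\<omega>. norm (X \<omega> - s i \<omega>) \<partial>M)) \<longlonglongrightarrow> 0"
        using ennreal_tendsto_cmult[OF _ lim] by simp
    qed
    show "(\<lambda>i. Bochner_Integration.simple_bochner_integral M (\<lambda>\<omega>. f (s i \<omega>))) \<longlonglongrightarrow> f v"
      using f.tendsto[OF v] s
      by (simp add: Bochner_Integration.simple_bochner_integral_linear f.linear_axioms)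
  qed
qed

text \<open>\<open>X\<close> and \<open>Y\<close> have the same vector integral \<open>v\<close>
  over \<open>A\<close>; applying \<open>f\<close> and subtracting leaves
  \<open>f v - f v\<close>.\<close>

lemma is_cond_expectation_functional:
  fixes f :: "'e::real_normed_vector \<Rightarrow> real"
  assumes "bounded_linear f" "is_cond_expectation M G X Y" "A \<in> sets G"
  shows "(LINT \<omega>:A|M. f (X \<omega> - Y \<omega>)) = 0"
proof -
  interpret f: bounded_linear f by fact
  obtain v where "has_vector_integral M (\<lambda>\<omega>. indicator A \<omega> *\<^sub>R X \<omega>) v"
      "has_vector_integral M (\<lambda>\<omega>. indicator A \<omega> *\<^sub>R Y \<omega>) v"
    using assms unfolding is_cond_expectation_def by blast
  from this[THEN has_vector_integral_bounded_linear[OF assms(1)]]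
  have "has_bochner_integral M (\<lambda>\<omega>. f (indicator A \<omega> *\<^sub>R X \<omega>) - f (indicator A \<omega> *\<^sub>R Y \<omega>)) (f v - f v)"
    by (rule has_bochner_integral_diff)
  then show ?thesis
    unfolding set_lebesgue_integral_def
    by (simp add: f.scaleR f.diff right_diff_distrib has_bochner_integral_integral_eq)
qed

text \<open>With countably many indices, measurability can be checked with the index held fixed,
  where the map is continuous in \<open>X\<close>.\<close>

lemma borel_measurable_selected_functional:
  fixes f :: "'i::countable \<Rightarrow> 'e::real_normed_vector \<Rightarrow> real"
  assumes "X \<in> borel_measurable N" "g \<in> measurable N (count_space UNIV)"
    and "\<And>i. bounded_linear (f i)"
  shows "(\<lambda>\<omega>. f (g \<omega>) (X \<omega> - v)) \<in> borel_measurable N"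
proof (rule measurable_compose_countable[OF _ assms(2)])
  fix i
  have "continuous_on UNIV (\<lambda>e. f i (e - v))"
    by (intro bounded_linear.continuous_on[OF assms(3)] continuous_intros)
  then show "(\<lambda>\<omega>. f i (X \<omega> - v)) \<in> borel_measurable N"
    by (intro measurable_compose[OF assms(1)] borel_measurable_continuous_onI)
qed

text \<open>Cut \<open>A\<close> into countably many pieces in \<open>G\<close> on which the
  selector is constant. On each piece a single functional acts and its integral vanishes; countable
  additivity does the rest.\<close>

lemma set_integral_selected_functional_eq_0:
  fixes f :: "'i::countable \<Rightarrow> 'e::real_normed_vector \<Rightarrow> real"
  assumes "is_cond_expectation M G X (\<lambda>_. v)" "A \<in> sets G"
    and g: "g \<in> measurable G (count_space UNIV)"
    and f: "\<And>i. bounded_linear (f i)"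
    and int: "integrable M (\<lambda>\<omega>. f (g \<omega>) (X \<omega> - v))"
  shows "(LINT \<omega>:A|M. f (g \<omega>) (X \<omega> - v)) = 0"
proof -
  have sub: "subalgebra M G" using assms(1) unfolding is_cond_expectation_def by blast
  \<comment> \<open>On \<open>B i\<close> the selector equals \<open>from_nat i\<close>; numbers
    that encode no value of \<open>g\<close> give empty pieces.\<close>
  define B where "B i = A \<inter> {\<omega> \<in> space G. to_nat (g \<omega>) = i}" for i
  have BG: "B i \<in> sets G" for i
    unfolding B_def using g assms(2) by measurable
  then have BM: "B i \<in> sets M" for i
    using sub unfolding subalgebra_def by blast
  have AM: "A \<in> sets M" using assms(2) sub unfolding subalgebra_def by blast
  have A: "A = (\<Union>i. B i)"
    using sets.sets_into_space[OF assms(2)] by (auto simp: B_def)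
  have "(LINT \<omega>:A|M. f (g \<omega>) (X \<omega> - v)) = (\<Sum>i. LINT \<omega>:B i|M. f (g \<omega>) (X \<omega> - v))"
    unfolding A
  proof (rule lebesgue_integral_countable_add[OF BM])
    show "B i \<inter> B j = {}" if "i \<noteq> j" for i j using that by (auto simp: B_def)
    show "set_integrable M (\<Union>i. B i) (\<lambda>\<omega>. f (g \<omega>) (X \<omega> - v))"
      unfolding A[symmetric] set_integrable_def by (rule integrable_mult_indicator[OF AM int])
  qed
  also have "\<dots> = (\<Sum>i. LINT \<omega>:B i|M. f (from_nat i) (X \<omega> - v))"
    using BM by (intro suminf_cong set_lebesgue_integral_cong) (auto simp: B_def)
  also have "\<dots> = 0"
    using is_cond_expectation_functional[OF f assms(1) BG] by simp
  finally show ?thesis .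
qed

section \<open>Discretisation\<close>

text \<open>Lists over a countable type are countable, so a whole finite history can serve as one
  countable-valued selector.\<close>

lemma measurable_map_count_space:
  fixes p :: "'a \<Rightarrow> 'w \<Rightarrow> 'b::countable"
  assumes "\<And>s. s \<in> set ss \<Longrightarrow> p s \<in> measurable N (count_space UNIV)"
  shows "(\<lambda>\<omega>. map (\<lambda>s. p s \<omega>) ss) \<in> measurable N (count_space UNIV)"
  using assms
proof (induction ss)
  case (Cons s ss)
  have IH: "(\<lambda>\<omega>. map (\<lambda>s. p s \<omega>) ss) \<in> measurable N (count_space UNIV)"
    and ps: "p s \<in> measurable N (count_space UNIV)"
    using Cons by auto
  have "(\<lambda>\<omega>. i # map (\<lambda>s. p s \<omega>) ss) \<in> measurable N (count_space UNIV)" for i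
    using measurable_compose[OF IH, of "\<lambda>xs. i # xs" "count_space UNIV"] by simp
  then have "(\<lambda>\<omega>. p s \<omega> # map (\<lambda>s. p s \<omega>) ss) \<in> measurable N (count_space UNIV)"
    by (rule measurable_compose_countable[OF _ ps])
  then show ?case by simp
qed simp

text \<open>
  The index of the approximating point is measurable for every sigma-algebra that makes \<open>X\<close>
  measurable, hence for the past of a process.
\<close>

lemma strongly_measurable_discretise:
  fixes X :: "'w \<Rightarrow> 'e::real_normed_vector"
  assumes "strongly_measurable M X" "0 < \<eta>"
  obtains d :: "nat \<Rightarrow> 'e" and p :: "'w \<Rightarrow> nat"
  where "\<And>\<omega>. \<omega> \<in> space M \<Longrightarrow> norm (X \<omega> - d (p \<omega>)) \<le> \<eta>"
    and "\<And>N. X \<in> borel_measurable N \<Longrightarrow> p \<in> measurable N (count_space UNIV)"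
proof -
  obtain S where S: "countable S" "X ` space M \<subseteq> closure S"
    using assms(1) unfolding strongly_measurable_def by blast
  define d where "d = from_nat_into S"
  \<comment> \<open>The first enumerated point within \<eta>. The least index depends on
    \<open>X\<close> only through countably many distance conditions, hence measurably.\<close>
  define p where "p \<omega> = (LEAST k. dist (d k) (X \<omega>) < \<eta>)" for \<omega>
  show thesis
  proof
    fix \<omega> assume "\<omega> \<in> space M"
    then have "X \<omega> \<in> closure S" using S(2) by blast
    then obtain y where y: "y \<in> S" "dist y (X \<omega>) < \<eta>"
      using \<open>0 < \<eta>\<close> unfolding closure_approachable by blast
    then have "dist (d (to_nat_on S y)) (X \<omega>) < \<eta>"
      using S(1) by (simp add: d_def)
    then have "dist (d (p \<omega>)) (X \<omega>) < \<eta>"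
      unfolding p_def by (rule LeastI)
    then show "norm (X \<omega> - d (p \<omega>)) \<le> \<eta>" by (simp add: dist_norm norm_minus_commute)
  next
    fix N assume X: "X \<in> borel_measurable N"
    have [measurable]: "(\<lambda>\<omega>. dist (d k) (X \<omega>)) \<in> borel_measurable N" for k
      by (rule measurable_compose[OF X])
        (auto intro!: borel_measurable_continuous_onI continuous_intros)
    show "p \<in> measurable N (count_space UNIV)" unfolding p_def by measurable
  qed
qed

lemma borel_measurable_past:
  fixes a :: "nat \<Rightarrow> 'w \<Rightarrow> 'e::real_normed_vector"
  assumes "s \<in> {1..<t}"
  shows "a s \<in> borel_measurable (past M a t)"
proof (rule measurableI)
  let ?E = "{a s -` B \<inter> space M | s B. s \<in> {1..<t} \<and> B \<in> sets borel}"
  have E: "?E \<subseteq> Pow (space M)" by blast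
  fix B :: "'e set" assume "B \<in> sets borel"
  then have "a s -` B \<inter> space M \<in> ?E" using assms by blast
  then show "a s -` B \<inter> space (past M a t) \<in> sets (past M a t)"
    using E by (simp add: past_def)
qed simp

section \<open>The concentration inequality\<close>

theorem lemma2p5:
  fixes M :: "'w measure"
    and F :: "'e::real_normed_vector \<Rightarrow> real"
    and a :: "nat \<Rightarrow> 'w \<Rightarrow> 'e" and x :: "nat \<Rightarrow> 'e"
    and l :: "nat \<Rightarrow> real" and T :: nat
    and L0 L1 D \<beta> :: real
  assumes "prob_space M"
    and "lipschitz_by_gradient L0 F"
    and "smooth_by_gradient L1 F"
    and "0 \<le> L1" and "0 < L0 \<or> 0 < L1" and "0 < D"
    and "l \<in> prob_simplex T"
    and "\<And>t. t \<in> {1..T} \<Longrightarrow> strongly_measurable M (a t)"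
    and "\<And>t. t \<in> {1..T} \<Longrightarrow> is_cond_expectation M (past M a t) (a t) (\<lambda>_. x t)"
    and "\<And>t. t \<in> {1..T} \<Longrightarrow> AE \<omega> in M. norm (x t - a t \<omega>) \<le> D"
    and "0 < \<beta>"
  shows "measure M {\<omega> \<in> space M.
           F (\<Sum>t=1..T. l t *\<^sub>R a t \<omega>) - F (\<Sum>t=1..T. l t *\<^sub>R x t)
             \<ge> L1 * D\<^sup>2 / 2 * (\<Sum>t=1..T. (l t)\<^sup>2)
               + \<beta> * sqrt 2 * L0 * D * sqrt (\<Sum>t=1..T. (l t)\<^sup>2)}
         \<le> exp (- \<beta>\<^sup>2)"
    (is "measure M ?S \<le> _")
proof -
  interpret prob_space M by fact
  define S where "S = ?S"
  define V where "V = (\<Sum>t=1..T. (l t)\<^sup>2)"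
  have l: "0 \<le> l t" if "t \<in> {1..T}" for t
    using assms(7) that by (auto simp: prob_simplex_def)
  have l_sum: "(\<Sum>t=1..T. l t) = 1"
    using assms(7) by (auto simp: prob_simplex_def)
  \<comment> \<open>Weights that sum to 1 cannot all vanish; in particular \<open>T = 0\<close> is
    excluded.\<close>
  have V: "0 < V"
  proof (rule ccontr)
    assume "\<not> 0 < V"
    moreover have "0 \<le> V" unfolding V_def by (intro sum_nonneg) auto
    ultimately have "V = 0" by simp
    then have "\<forall>t\<in>{1..T}. l t = 0" unfolding V_def by (simp add: sum_nonneg_eq_0_iff)
    then show False using l_sum by simp
  qed
  have "measure M S \<le> exp (- \<beta>\<^sup>2)"
  proof (cases "L0 = 0")
    \<comment> \<open>Here \<open>\<theta>\<close> below would divide by zero. But \<open>F\<close>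
      is constant, \<open>L1\<close> must be positive, and the event asks 0 to exceed a positive
      number.\<close>
    case True
    have F'_0: "frechet_derivative F (at u) = (\<lambda>_. 0)" for u
      using abs_bounded_linear_le[OF lipschitz_by_gradientD(2,3)[OF assms(2)] order_refl, of u] True
      by (simp add: fun_eq_iff)
    have "(F has_derivative (\<lambda>_. 0)) (at u)" for u
      using lipschitz_by_gradientD(1)[OF assms(2), of u] by (simp add: F'_0)
    then obtain k where "F u = k" for u
      using has_derivative_zero_constant[of UNIV F] by auto
    moreover have "0 < L1 * D\<^sup>2 / 2 * V"
      using assms(5,6) True V by simp
    ultimately have "S = {}"
      using True by (auto simp: S_def V_def)
    then show ?thesis by simp
  next
    case False
    then have L0: "0 < L0" using lipschitz_by_gradientD(4)[OF assms(2)] by simp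
    \<comment> \<open>\<open>W\<^sup>2\<close> is the sum of the squared bounds
      \<open>l t * (L0 * D)\<close>. The chosen \<theta> minimises the Chernoff exponent
      \<open>\<theta>\<^sup>2 * W\<^sup>2 / 2 - \<theta> * \<beta> * sqrt 2 * W\<close>, with
      minimum \<open>- \<beta>\<^sup>2\<close>.\<close>
    define W where "W = L0 * D * sqrt V"
    define \<theta> where "\<theta> = \<beta> * sqrt 2 / W"
    have W: "0 < W" unfolding W_def using L0 assms(6) V by simp
    have \<theta>: "0 < \<theta>" unfolding \<theta>_def using W assms(11) by simp
    have approx: "measure M S \<le> exp (- \<beta>\<^sup>2 + \<theta> * (L1 * \<eta> * D))" if \<eta>: "0 < \<eta>" for \<eta>
    proof (cases "S \<in> sets M")
      \<comment> \<open>\<open>measure\<close> is 0 by default outside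
        \<open>sets M\<close>.\<close>
      case False
      then show ?thesis by (simp add: measure_notin_sets)
    next
      case True
      \<comment> \<open>The points and the index map are bundled into one pair, to be chosen for all
        \<open>t\<close> at once.\<close>
      define P where "P t dp \<longleftrightarrow>
          (\<forall>\<omega>\<in>space M. norm (a t \<omega> - fst dp (snd dp \<omega>)) \<le> \<eta>) \<and>
          (\<forall>N. a t \<in> borel_measurable N \<longrightarrow> snd dp \<in> measurable N (count_space (UNIV :: nat set)))"
        for t dp
      have "\<exists>dp. P t dp" if t: "t \<in> {1..T}" for t
      proof -
        obtain d p where "\<And>\<omega>. \<omega> \<in> space M \<Longrightarrow> norm (a t \<omega> - d (p \<omega>)) \<le> \<eta>"
          and "\<And>N. a t \<in> borel_measurable N \<Longrightarrow> p \<in> measurable N (count_space (UNIV :: nat set))"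
          using strongly_measurable_discretise[OF assms(8)[OF t] \<eta>] by blast
        then have "P t (d, p)" by (simp add: P_def)
        then show ?thesis ..
      qed
      then obtain dp where dp: "\<And>t. t \<in> {1..T} \<Longrightarrow> P t (dp t)"
        using bchoice[of "{1..T}" P] by blast
      define d where "d t = fst (dp t)" for t
      define p where "p t = snd (dp t)" for t
      have d: "norm (a t \<omega> - d t (p t \<omega>)) \<le> \<eta>" if "t \<in> {1..T}" "\<omega> \<in> space M" for t \<omega>
        using dp[OF that(1)] that(2) unfolding d_def p_def P_def by blast
      have p: "p t \<in> measurable N (count_space UNIV)"
        if "t \<in> {1..T}" "a t \<in> borel_measurable N" for t N
        using dp[OF that(1)] that(2) unfolding p_def P_def by blast
      define xbar where "xbar = (\<Sum>t=1..T. l t *\<^sub>R x t)"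
      \<comment> \<open>The discretised path before step \<open>t\<close>, as a function of the
        index list alone. Lists count from 0 and steps from 1, hence position
        \<open>s - 1\<close>.\<close>
      define pt where "pt t ks = xbar + (\<Sum>s\<in>{1..<t}. l s *\<^sub>R (d s (ks ! (s - 1)) - x s))"
        for t and ks :: "nat list"
      define hist where "hist t \<omega> = map (\<lambda>s. p s \<omega>) [1..<t]" for t \<omega>
      define f where "f t ks h = l t * frechet_derivative F (at (pt t ks)) h" for t ks h
      define Z where "Z t \<omega> = f t (hist t \<omega>) (a t \<omega> - x t)" for t \<omega>
      have f: "bounded_linear (f t ks)" for t ks
        unfolding f_def by (intro bounded_linear_const_mult lipschitz_by_gradientD(2)[OF assms(2)])
      have a_M: "a t \<in> borel_measurable M" if "t \<in> {1..T}" for t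
        using assms(8)[OF that] by (simp add: strongly_measurable_def)
      have hist: "hist t \<in> measurable N (count_space UNIV)"
        if "t \<in> {1..T}" "\<And>s. s \<in> {1..<t} \<Longrightarrow> a s \<in> borel_measurable N" for t N
        unfolding hist_def by (rule measurable_map_count_space) (use that p in auto)
      \<comment> \<open>Keeping \<open>N\<close> arbitrary covers both \<open>M\<close> and the past
        of any later step.\<close>
      have Z_N: "Z t \<in> borel_measurable N"
        if "t \<in> {1..T}" "\<And>s. s \<in> {1..t} \<Longrightarrow> a s \<in> borel_measurable N" for t N
        unfolding Z_def using that by (intro borel_measurable_selected_functional f hist) auto
      have Z_M: "Z t \<in> borel_measurable M" if "t \<in> {1..T}" for t
        using that a_M by (intro Z_N) auto
      have Z_bound: "AE \<omega> in M. \<bar>Z t \<omega>\<bar> \<le> l t * (L0 * D)" if "t \<in> {1..T}" for t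
        using assms(10)[OF that]
      proof eventually_elim
        case (elim \<omega>)
        then have "\<bar>frechet_derivative F (at (pt t (hist t \<omega>))) (a t \<omega> - x t)\<bar> \<le> L0 * D"
          by (intro abs_bounded_linear_le lipschitz_by_gradientD[OF assms(2)])
            (simp add: norm_minus_commute)
        then show ?case
          using l[OF that] by (simp add: Z_def f_def abs_mult mult_left_mono)
      qed
      have Z_mean: "(LINT \<omega>:A|M. Z t \<omega>) = 0" if t: "t \<in> {1..T}" and A: "A \<in> sets (past M a t)" for t A
        unfolding Z_def
      proof (rule set_integral_selected_functional_eq_0[OF assms(9)[OF t] A _ f])
        show "hist t \<in> measurable (past M a t) (count_space UNIV)"
          by (intro hist t borel_measurable_past)
        have "integrable M (Z t)"
          using Z_bound[OF t] Z_M[OF t] by (intro integrable_const_bound) auto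
        then show "integrable M (\<lambda>\<omega>. f t (hist t \<omega>) (a t \<omega> - x t))"
          by (simp add: Z_def[abs_def])
      qed
      have sub: "subalgebra M (past M a t)" if "t \<in> {1..T}" for t
        using assms(9)[OF that] unfolding is_cond_expectation_def by blast
      have Z_past: "Z s \<in> borel_measurable (past M a t)" if "t \<in> {1..T}" "s \<in> {1..<t}" for s t
        using that by (intro Z_N borel_measurable_past) auto
      define E where "E \<omega> = exp (\<theta> * (\<Sum>t=1..T. Z t \<omega>))" for \<omega>
      have E: "integrable M E" "(\<integral>\<omega>. E \<omega> \<partial>M) \<le> exp (\<theta>\<^sup>2 / 2 * (\<Sum>t=1..T. (l t * (L0 * D))\<^sup>2))"
        unfolding E_def
        by (rule exp_sum_martingale_differences_le[where G = "past M a" and c = "\<lambda>t. l t * (L0 * D)",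
              OF assms(1) less_imp_le[OF \<theta>] sub Z_past Z_M Z_bound Z_mean]; assumption)+
      have "(\<Sum>t=1..T. (l t * (L0 * D))\<^sup>2) = W\<^sup>2"
        using V by (simp add: W_def V_def power_mult_distrib sum_distrib_left mult_ac)
      then have E_le: "(\<integral>\<omega>. E \<omega> \<partial>M) \<le> exp (\<beta>\<^sup>2)"
        using E(2) W by (simp add: \<theta>_def power_divide power_mult_distrib)
      \<comment> \<open>The deviation term of the threshold minus the total discretisation
        loss.\<close>
      define \<epsilon> where "\<epsilon> = \<beta> * sqrt 2 * W - L1 * \<eta> * D"
      have "AE \<omega> in M. \<omega> \<in> S \<longrightarrow> \<omega> \<in> {\<omega> \<in> space M. exp (\<theta> * \<epsilon>) \<le> E \<omega>}"
      proof -
        have "AE \<omega> in M. \<forall>t\<in>{1..T}. norm (x t - a t \<omega>) \<le> D"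
          using assms(10) by (intro AE_finite_allI) auto
        then show ?thesis
        proof eventually_elim
          case (elim \<omega>)
          show ?case
          proof
            assume \<omega>: "\<omega> \<in> S"
            \<comment> \<open>Each earlier step errs by at most \<open>l s * \<eta>\<close>, and the
              weights sum to 1, so the errors do not accumulate beyond \<eta>.\<close>
            have close: "norm (xbar + (\<Sum>s\<in>{1..<t}. l s *\<^sub>R (a s \<omega> - x s)) - pt t (hist t \<omega>)) \<le> \<eta>"
              if t: "t \<in> {1..T}" for t
            proof -
              have "xbar + (\<Sum>s\<in>{1..<t}. l s *\<^sub>R (a s \<omega> - x s)) - pt t (hist t \<omega>)
                  = (\<Sum>s\<in>{1..<t}. l s *\<^sub>R (a s \<omega> - d s (p s \<omega>)))"
                by (auto simp: pt_def hist_def simp flip: sum_subtractf scaleR_diff_right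
                    intro!: sum.cong)
              also have "norm \<dots> \<le> (\<Sum>s\<in>{1..<t}. l s * \<eta>)"
              proof (rule sum_norm_le)
                fix s assume "s \<in> {1..<t}"
                then have "s \<in> {1..T}" using t by auto
                then show "norm (l s *\<^sub>R (a s \<omega> - d s (p s \<omega>))) \<le> l s * \<eta>"
                  using d[of s \<omega>] l[of s] \<omega> by (simp add: S_def mult_left_mono)
              qed
              also have "\<dots> \<le> (\<Sum>s=1..T. l s * \<eta>)"
                using t l \<eta> by (intro sum_mono2) auto
              also have "\<dots> = \<eta>" using l_sum by (simp flip: sum_distrib_right)
              finally show ?thesis .
            qed
            have "F (xbar + (\<Sum>t=1..T. l t *\<^sub>R (a t \<omega> - x t))) \<le> F xbar
                + (\<Sum>t=1..T. frechet_derivative F (at (pt t (hist t \<omega>))) (l t *\<^sub>R (a t \<omega> - x t)))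
                + L1 * D\<^sup>2 / 2 * (\<Sum>t=1..T. (l t)\<^sup>2) + L1 * \<eta> * D * (\<Sum>t=1..T. l t)"
              using elim close l
              by (intro smooth_along_path_upper_bound[OF assms(3,4)]) (auto simp: norm_minus_commute)
            moreover have "frechet_derivative F (at (pt t (hist t \<omega>))) (l t *\<^sub>R (a t \<omega> - x t)) = Z t \<omega>" for t
              using linear_cmul[OF bounded_linear.linear[OF lipschitz_by_gradientD(2)[OF assms(2)]]]
              by (simp add: Z_def f_def)
            moreover have "xbar + (\<Sum>t=1..T. l t *\<^sub>R (a t \<omega> - x t)) = (\<Sum>t=1..T. l t *\<^sub>R a t \<omega>)"
              by (simp add: xbar_def scaleR_diff_right sum_subtractf)
            \<comment> \<open>The quadratic term of the path bound cancels against the first term of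
              the threshold.\<close>
            ultimately have "\<epsilon> \<le> (\<Sum>t=1..T. Z t \<omega>)"
              using \<omega> l_sum by (simp add: S_def \<epsilon>_def W_def V_def xbar_def mult_ac)
            then show "\<omega> \<in> {\<omega> \<in> space M. exp (\<theta> * \<epsilon>) \<le> E \<omega>}"
              using \<omega> \<theta> by (simp add: S_def E_def)
          qed
        qed
      qed
      then have "measure M S \<le> measure M {\<omega> \<in> space M. exp (\<theta> * \<epsilon>) \<le> E \<omega>}"
        by (rule finite_measure_mono_AE) (use borel_measurable_integrable[OF E(1)] in measurable)
      also have "\<dots> \<le> (\<integral>\<omega>. E \<omega> \<partial>M) / exp (\<theta> * \<epsilon>)"
        by (rule integral_Markov_inequality_measure[OF E(1) sets.empty_sets]) (auto simp: E_def)
      also have "\<dots> \<le> exp (\<beta>\<^sup>2) / exp (\<theta> * \<epsilon>)"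
        using E_le by (simp add: divide_right_mono)
      also have "\<theta> * \<epsilon> = 2 * \<beta>\<^sup>2 - \<theta> * (L1 * \<eta> * D)"
        using W by (simp add: \<theta>_def \<epsilon>_def right_diff_distrib power2_eq_square)
      also have "exp (\<beta>\<^sup>2) / exp (2 * \<beta>\<^sup>2 - \<theta> * (L1 * \<eta> * D)) = exp (- \<beta>\<^sup>2 + \<theta> * (L1 * \<eta> * D))"
        by (simp flip: exp_diff)
      finally show ?thesis .
    qed
    \<comment> \<open>Neither \<open>S\<close> nor \<theta> depends on \<eta>, so the bound passes
      to the limit.\<close>
    have "((\<lambda>\<eta>. exp (- \<beta>\<^sup>2 + \<theta> * (L1 * \<eta> * D))) \<longlongrightarrow> exp (- \<beta>\<^sup>2 + \<theta> * (L1 * 0 * D))) (at_right 0)"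
      by (intro tendsto_intros)
    moreover have "\<forall>\<^sub>F \<eta> in at_right 0. measure M S \<le> exp (- \<beta>\<^sup>2 + \<theta> * (L1 * \<eta> * D))"
      using eventually_at_right_less[of 0] by eventually_elim (rule approx)
    ultimately have "measure M S \<le> exp (- \<beta>\<^sup>2 + \<theta> * (L1 * 0 * D))"
      by (intro tendsto_lowerbound) auto
    then show ?thesis by simp
  qed
  then show ?thesis by (simp only: S_def)
qed

end
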